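(* A covering $p:\Omega\to\Lambda$ of $k$-graphs is connected if and only if the corresponding groupoid action $(\Omega^0,\mathcal G(\Lambda))$ is transitive.
   Context: A $k$-graph is a small category $\Lambda$ (nonempty) with a functor $d:\Lambda\to\mathbb N^k$ (the degree) satisfying the factorization property: if $d(\alpha)=n+l$ with $n,l\in\mathbb N^k$, there are unique $\beta,\gamma\in\Lambda$ with $d(\beta)=n$, $d(\gamma)=l$, $\alpha=\beta\gamma$. $\Lambda^0$ is the set of objects (vertices, identified with identity morphisms); $s(\alpha)$ and $r(\alpha)$ are the domain and codomain of $\alpha$. $u\mathcal C=r^{-1}(u)$, $\mathcal C v=s^{-1}(v)$, $u\mathcal Cv=u\mathcal C\cap\mathcal Cv$. A small category $\mathcal C$ is connected if the equivalence relation on $\mathcal C^0$ generated by $\{(u,v)\mid u\mathcal Cv\neq\emptyset\}$ is all of $\mathcal C^0\times\mathcal C^0$. A $k$-graph morphism is a degree-preserving functor. A covering of $\Lambda$ is a surjective $k$-graph morphism $p:\Omega\to\Lambda$ such that for all $v\in\Omega^0$, $p$ maps $\Omega v$ bijectively onto $\Lambda p(v)$ and $v\Omega$ bijectively onto $p(v)\Lambda$. It is connected if $\Omega$ is connected. The fundamental groupoid of $\Lambda$ is the groupoid $\mathcal G(\Lambda)$ with $\mathcal G(\Lambda)^0=\Lambda^0$, together with a functor $i:\Lambda\to\mathcal G(\Lambda)$ that is the identity on $\Lambda^0$, such that every functor from $\Lambda$ to a groupoid factors uniquely through $i$. An action of a groupoid $\mathcal G$ on a set $V$ is a functor $T$ from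 $\mathcal G$ to sets such that $V$ is the disjoint union of the sets $V_x:=T(x)$, $x\in\mathcal G^0$; write $av=T(a)(v)$ for $v\in V_{s(a)}$. It is transitive if $V=\mathcal Gv$ for some (hence every) $v\in V$. The action corresponding to a covering $p:\Omega\to\Lambda$ is the unique action of $\mathcal G(\Lambda)$ on $\Omega^0$ (with fibres $p^{-1}(x)$, $x\in\Lambda^0$) such that $i(\alpha)v=r(\lambda)$ if $\alpha=p(\lambda)$ and $v=s(\lambda)$, $\lambda\in\Omega$. *)

theory Defs
  imports "HOL-Library.FuncSet" "HOL-Library.Disjoint_Sets"
begin

section \<open>Small categories, functors and groupoids\<close>

text \<open>
  The composite \<open>cmp C a b\<close> is written \<open>ab\<close> in the source and is meaningful when
  \<open>src C a = rng C b\<close>, where \<open>src\<close> is the domain and \<open>rng\<close> the codomain (range).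
\<close>

record ('o, 'm) category =
  Obj :: "'o set"
  Mor :: "'m set"
  src :: "'m \<Rightarrow> 'o"
  rng :: "'m \<Rightarrow> 'o"
  idt :: "'o \<Rightarrow> 'm"
  cmp :: "'m \<Rightarrow> 'm \<Rightarrow> 'm"

locale small_category =
  fixes C :: "('o, 'm, 'z) category_scheme"
  assumes src_Obj: "a \<in> Mor C \<Longrightarrow> src C a \<in> Obj C"
    and rng_Obj: "a \<in> Mor C \<Longrightarrow> rng C a \<in> Obj C"
    and idt_Mor: "x \<in> Obj C \<Longrightarrow> idt C x \<in> Mor C"
    and src_idt: "x \<in> Obj C \<Longrightarrow> src C (idt C x) = x"
    and rng_idt: "x \<in> Obj C \<Longrightarrow> rng C (idt C x) = x"
    and cmp_Mor: "a \<in> Mor C \<Longrightarrow> b \<in> Mor C \<Longrightarrow> src C a = rng C b \<Longrightarrow> cmp C a b \<in> Mor C"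
    and src_cmp: "a \<in> Mor C \<Longrightarrow> b \<in> Mor C \<Longrightarrow> src C a = rng C b \<Longrightarrow> src C (cmp C a b) = src C b"
    and rng_cmp: "a \<in> Mor C \<Longrightarrow> b \<in> Mor C \<Longrightarrow> src C a = rng C b \<Longrightarrow> rng C (cmp C a b) = rng C a"
    and cmp_idt_left: "a \<in> Mor C \<Longrightarrow> cmp C (idt C (rng C a)) a = a"
    and cmp_idt_right: "a \<in> Mor C \<Longrightarrow> cmp C a (idt C (src C a)) = a"
    and cmp_assoc: "a \<in> Mor C \<Longrightarrow> b \<in> Mor C \<Longrightarrow> c \<in> Mor C \<Longrightarrow> src C a = rng C b \<Longrightarrow>
      src C b = rng C c \<Longrightarrow> cmp C (cmp C a b) c = cmp C a (cmp C b c)"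

definition inverse_of :: "('o, 'm, 'z) category_scheme \<Rightarrow> 'm \<Rightarrow> 'm \<Rightarrow> bool" where
  "inverse_of C a b \<longleftrightarrow> b \<in> Mor C \<and> src C b = rng C a \<and> rng C b = src C a \<and>
     cmp C a b = idt C (rng C a) \<and> cmp C b a = idt C (src C a)"

locale groupoid = small_category +
  assumes ex_inverse: "a \<in> Mor C \<Longrightarrow> \<exists>b. inverse_of C a b"

locale cat_functor =
  fixes C :: "('o1, 'm1, 'z1) category_scheme" and D :: "('o2, 'm2, 'z2) category_scheme"
    and FO :: "'o1 \<Rightarrow> 'o2" and FM :: "'m1 \<Rightarrow> 'm2"
  assumes FO_Obj: "x \<in> Obj C \<Longrightarrow> FO x \<in> Obj D"
    and FM_Mor: "a \<in> Mor C \<Longrightarrow> FM a \<in> Mor D"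
    and FM_src: "a \<in> Mor C \<Longrightarrow> src D (FM a) = FO (src C a)"
    and FM_rng: "a \<in> Mor C \<Longrightarrow> rng D (FM a) = FO (rng C a)"
    and FM_idt: "x \<in> Obj C \<Longrightarrow> FM (idt C x) = idt D (FO x)"
    and FM_cmp: "a \<in> Mor C \<Longrightarrow> b \<in> Mor C \<Longrightarrow> src C a = rng C b \<Longrightarrow>
      FM (cmp C a b) = cmp D (FM a) (FM b)"

definition cat_connected :: "('o, 'm, 'z) category_scheme \<Rightarrow> bool" where
  "cat_connected C \<longleftrightarrow>
     \<Inter>{R. equiv (Obj C) R \<and> {(u, v). \<exists>a\<in>Mor C. rng C a = u \<and> src C a = v} \<subseteq> R} = Obj C \<times> Obj C"


section \<open>\<open>k\<close>-graphs and coverings\<close>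

text \<open>\<open>\<nat>\<^sup>k\<close> is represented by the functions on \<open>nat\<close> that vanish from \<open>k\<close> on.\<close>

definition degrees :: "nat \<Rightarrow> (nat \<Rightarrow> nat) set" where
  "degrees k = {n. \<forall>j\<ge>k. n j = 0}"

record ('o, 'm) graded_category = "('o, 'm) category" +
  deg :: "'m \<Rightarrow> nat \<Rightarrow> nat"

locale kgraph = small_category \<Lambda>
  for k :: nat and \<Lambda> :: "('o, 'm, 'z) graded_category_scheme" +
  assumes nonempty: "Obj \<Lambda> \<noteq> {}"
    and deg_degrees: "\<alpha> \<in> Mor \<Lambda> \<Longrightarrow> deg \<Lambda> \<alpha> \<in> degrees k"
    and deg_idt: "x \<in> Obj \<Lambda> \<Longrightarrow> deg \<Lambda> (idt \<Lambda> x) = (\<lambda>j. 0)"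
    and deg_cmp: "\<alpha> \<in> Mor \<Lambda> \<Longrightarrow> \<beta> \<in> Mor \<Lambda> \<Longrightarrow> src \<Lambda> \<alpha> = rng \<Lambda> \<beta> \<Longrightarrow>
      deg \<Lambda> (cmp \<Lambda> \<alpha> \<beta>) = (\<lambda>j. deg \<Lambda> \<alpha> j + deg \<Lambda> \<beta> j)"
    and factorization: "\<alpha> \<in> Mor \<Lambda> \<Longrightarrow> n \<in> degrees k \<Longrightarrow> l \<in> degrees k \<Longrightarrow>
      deg \<Lambda> \<alpha> = (\<lambda>j. n j + l j) \<Longrightarrow>
      \<exists>!(\<beta>, \<gamma>). \<beta> \<in> Mor \<Lambda> \<and> \<gamma> \<in> Mor \<Lambda> \<and> src \<Lambda> \<beta> = rng \<Lambda> \<gamma> \<and>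
        deg \<Lambda> \<beta> = n \<and> deg \<Lambda> \<gamma> = l \<and> \<alpha> = cmp \<Lambda> \<beta> \<gamma>"

locale kgraph_morphism = cat_functor \<Omega> \<Lambda> pO pM
  for \<Omega> :: "('a, 'b, 'y) graded_category_scheme" and \<Lambda> :: "('o, 'm, 'z) graded_category_scheme"
    and pO :: "'a \<Rightarrow> 'o" and pM :: "'b \<Rightarrow> 'm" +
  assumes deg_preserving: "\<mu> \<in> Mor \<Omega> \<Longrightarrow> deg \<Lambda> (pM \<mu>) = deg \<Omega> \<mu>"

text \<open>
  Surjectivity is stated for morphisms; with vertices regarded as identity
  morphisms, it includes surjectivity on vertices.
\<close>

locale kgraph_covering = \<Omega>: kgraph k \<Omega> + \<Lambda>: kgraph k \<Lambda> + kgraph_morphism \<Omega> \<Lambda> pO pM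
  for k :: nat and \<Omega> :: "('a, 'b, 'y) graded_category_scheme"
    and \<Lambda> :: "('o, 'm, 'z) graded_category_scheme"
    and pO :: "'a \<Rightarrow> 'o" and pM :: "'b \<Rightarrow> 'm" +
  assumes surjective: "pM ` Mor \<Omega> = Mor \<Lambda>"
    and bij_src: "v \<in> Obj \<Omega> \<Longrightarrow>
      bij_betw pM {\<mu> \<in> Mor \<Omega>. src \<Omega> \<mu> = v} {\<alpha> \<in> Mor \<Lambda>. src \<Lambda> \<alpha> = pO v}"
    and bij_rng: "v \<in> Obj \<Omega> \<Longrightarrow>
      bij_betw pM {\<mu> \<in> Mor \<Omega>. rng \<Omega> \<mu> = v} {\<alpha> \<in> Mor \<Lambda>. rng \<Lambda> \<alpha> = pO v}"


section \<open>The fundamental groupoid\<close>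

definition factors_uniquely ::
  "('o, 'm, 'z) category_scheme \<Rightarrow> ('o, 'g, 'y) category_scheme \<Rightarrow> ('m \<Rightarrow> 'g) \<Rightarrow>
   ('p, 'h, 'x) category_scheme \<Rightarrow> ('o \<Rightarrow> 'p) \<Rightarrow> ('m \<Rightarrow> 'h) \<Rightarrow> bool" where
  "factors_uniquely \<Lambda> G i H FO FM \<longleftrightarrow>
    (let factor = (\<lambda>KO KM. cat_functor G H KO KM \<and>
           (\<forall>x\<in>Obj \<Lambda>. KO x = FO x) \<and> (\<forall>\<alpha>\<in>Mor \<Lambda>. KM (i \<alpha>) = FM \<alpha>))
     in (\<exists>KO KM. factor KO KM) \<and>
        (\<forall>KO KM KO' KM'. factor KO KM \<and> factor KO' KM' \<longrightarrow>
           (\<forall>x\<in>Obj G. KO x = KO' x) \<and> (\<forall>g\<in>Mor G. KM g = KM' g)))"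

text \<open>
  HOL cannot quantify over types inside a formula, so in the definition the target groupoids
  range over one type only. Its morphism part holds (via \<open>Inl\<close>) codes for the morphisms of
  any groupoid generated by a functorial image of \<open>\<Lambda>\<close>, namely words in formal letters
  \<open>\<alpha>\<close>, \<open>\<alpha>\<^sup>-\<^sup>1\<close>, and (via \<open>Inr\<close>) a copy of \<open>G\<close>. This suffices for
  the universal property with respect to groupoids of arbitrary type, which is the theorem
  \<open>fundamental_groupoid_universal\<close> below; existence is \<open>fundamental_groupoid_exists\<close>.
\<close>

definition fundamental_groupoid ::
  "('o, 'm, 'z) category_scheme \<Rightarrow> ('o, 'g) category \<Rightarrow> ('m \<Rightarrow> 'g) \<Rightarrow> bool" where
  "fundamental_groupoid \<Lambda> G i \<longleftrightarrow>
     groupoid G \<and> Obj G = Obj \<Lambda> \<and> cat_functor \<Lambda> G (\<lambda>x. x) i \<and>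
     (\<forall>(H :: ('o, ('m \<times> bool) list + 'g) category) FO FM.
        groupoid H \<and> cat_functor \<Lambda> H FO FM \<longrightarrow> factors_uniquely \<Lambda> G i H FO FM)"


section \<open>Groupoid actions\<close>

text \<open>
  An action is a functor to sets: \<open>TO x\<close> is the set \<open>V\<^sub>x\<close>, and \<open>TM a\<close>, restricted to
  \<open>V\<^sub>x\<close> for \<open>x = src G a\<close>, is the map \<open>v \<mapsto> av\<close>.
\<close>

locale groupoid_action = groupoid G
  for G :: "('o, 'g, 'z) category_scheme" and V :: "'v set"
    and TO :: "'o \<Rightarrow> 'v set" and TM :: "'g \<Rightarrow> 'v \<Rightarrow> 'v" +
  assumes disjoint_fibres: "disjoint_family_on TO (Obj G)"
    and union_fibres: "(\<Union>x\<in>Obj G. TO x) = V"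
    and TM_maps: "a \<in> Mor G \<Longrightarrow> v \<in> TO (src G a) \<Longrightarrow> TM a v \<in> TO (rng G a)"
    and TM_idt: "x \<in> Obj G \<Longrightarrow> v \<in> TO x \<Longrightarrow> TM (idt G x) v = v"
    and TM_cmp: "a \<in> Mor G \<Longrightarrow> b \<in> Mor G \<Longrightarrow> src G a = rng G b \<Longrightarrow> v \<in> TO (src G b) \<Longrightarrow>
      TM (cmp G a b) v = TM a (TM b v)"

definition action_orbit ::
  "('o, 'g, 'z) category_scheme \<Rightarrow> ('o \<Rightarrow> 'v set) \<Rightarrow> ('g \<Rightarrow> 'v \<Rightarrow> 'v) \<Rightarrow> 'v \<Rightarrow> 'v set" where
  "action_orbit G TO TM v = {TM a v | a. a \<in> Mor G \<and> v \<in> TO (src G a)}"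

definition transitive_action ::
  "('o, 'g, 'z) category_scheme \<Rightarrow> 'v set \<Rightarrow> ('o \<Rightarrow> 'v set) \<Rightarrow> ('g \<Rightarrow> 'v \<Rightarrow> 'v) \<Rightarrow> bool" where
  "transitive_action G V TO TM \<longleftrightarrow> (\<exists>v\<in>V. V = action_orbit G TO TM v)"

text \<open>
  The action corresponding to a covering; \<open>covering_action_exists\<close> and
  \<open>covering_action_unique\<close> below show that there is exactly one.
\<close>

definition covering_action ::
  "('a, 'b, 'y) category_scheme \<Rightarrow> ('o, 'm, 'z) category_scheme \<Rightarrow> ('a \<Rightarrow> 'o) \<Rightarrow> ('b \<Rightarrow> 'm) \<Rightarrow>
   ('o, 'g) category \<Rightarrow> ('m \<Rightarrow> 'g) \<Rightarrow> ('o \<Rightarrow> 'a set) \<Rightarrow> ('g \<Rightarrow> 'a \<Rightarrow> 'a) \<Rightarrow> bool" where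
  "covering_action \<Omega> \<Lambda> pO pM G i TO TM \<longleftrightarrow>
     groupoid_action G (Obj \<Omega>) TO TM \<and>
     (\<forall>x\<in>Obj \<Lambda>. TO x = {v \<in> Obj \<Omega>. pO v = x}) \<and>
     (\<forall>\<mu>\<in>Mor \<Omega>. TM (i (pM \<mu>)) (src \<Omega> \<mu>) = rng \<Omega> \<mu>)"


section \<open>Generated subgroupoids\<close>

context small_category
begin

lemma inverse_of_unique:
  assumes "inverse_of C a b" "inverse_of C a c" "a \<in> Mor C"
  shows "b = c"
proof -
  have b: "b \<in> Mor C" "src C b = rng C a" "rng C b = src C a" "cmp C b a = idt C (src C a)"
    and c: "c \<in> Mor C" "src C c = rng C a" "rng C c = src C a" "cmp C a c = idt C (rng C a)"
    using assms by (auto simp: inverse_of_def)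
  have "b = cmp C b (cmp C a c)" using b c cmp_idt_right[of b] by simp
  also have "\<dots> = cmp C (cmp C b a) c" using b c assms(3) cmp_assoc[of b a c] by simp
  also have "\<dots> = c" using b c cmp_idt_left[of c] by simp
  finally show ?thesis .
qed

lemma inverse_of_sym: "inverse_of C a b \<Longrightarrow> a \<in> Mor C \<Longrightarrow> inverse_of C b a"
  by (auto simp: inverse_of_def)

lemma inverse_of_cmp:
  assumes "inverse_of C a a'" "inverse_of C b b'" "a \<in> Mor C" "b \<in> Mor C" "src C a = rng C b"
  shows "inverse_of C (cmp C a b) (cmp C b' a')"
proof -
  have a': "a' \<in> Mor C" "src C a' = rng C a" "rng C a' = src C a"
      "cmp C a a' = idt C (rng C a)" "cmp C a' a = idt C (src C a)"
    and b': "b' \<in> Mor C" "src C b' = rng C b" "rng C b' = src C b"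
      "cmp C b b' = idt C (rng C b)" "cmp C b' b = idt C (src C b)"
    using assms by (auto simp: inverse_of_def)
  note ty = a'(1-3) b'(1-3) assms(3-5) cmp_Mor src_cmp rng_cmp
  have "cmp C (cmp C a b) (cmp C b' a') = cmp C a (cmp C (cmp C b b') a')"
    using ty by (simp add: cmp_assoc)
  also have "\<dots> = idt C (rng C a)"
    using a' b' assms(3-5) cmp_idt_left[of a'] by simp
  finally have 1: "cmp C (cmp C a b) (cmp C b' a') = idt C (rng C a)" .
  have "cmp C (cmp C b' a') (cmp C a b) = cmp C b' (cmp C (cmp C a' a) b)"
    using ty by (simp add: cmp_assoc)
  also have "\<dots> = idt C (src C b)"
    using a' b' assms(3-5) cmp_idt_left[of b] by simp
  finally show ?thesis using 1 ty by (simp add: inverse_of_def)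
qed

end

lemma cat_functor_comp:
  assumes "cat_functor C D FO FM" "cat_functor D E KO KM"
  shows "cat_functor C E (\<lambda>x. KO (FO x)) (\<lambda>a. KM (FM a))"
  using assms by (simp add: cat_functor_def)

lemma cat_functor_inverse:
  assumes "cat_functor C D FO FM" "small_category C" "a \<in> Mor C" "inverse_of C a b"
  shows "inverse_of D (FM a) (FM b)"
proof -
  interpret cat_functor C D FO FM by fact
  interpret small_category C by fact
  have b: "b \<in> Mor C" "src C b = rng C a" "rng C b = src C a"
      "cmp C a b = idt C (rng C a)" "cmp C b a = idt C (src C a)"
    using assms(4) by (auto simp: inverse_of_def)
  show ?thesis unfolding inverse_of_def
    using b assms(3) FM_cmp[of a b] FM_cmp[of b a]
    by (simp add: FM_Mor FM_src FM_rng FM_idt src_Obj rng_Obj)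
qed

text \<open>
  The morphisms generated by the image of a functor \<open>F\<close> to a groupoid \<open>H\<close>; the letters are
  \<open>(\<alpha>, True)\<close> for \<open>F \<alpha>\<close> and \<open>(\<alpha>, False)\<close> for its inverse.
\<close>

definition letter_value :: "('p, 'h, 'x) category_scheme \<Rightarrow> ('m \<Rightarrow> 'h) \<Rightarrow> 'm \<times> bool \<Rightarrow> 'h" where
  "letter_value H FM l =
     (if snd l then FM (fst l) else (SOME b. inverse_of H (FM (fst l)) b))"

fun word_value :: "('p, 'h, 'x) category_scheme \<Rightarrow> ('m \<Rightarrow> 'h) \<Rightarrow> ('m \<times> bool) list \<Rightarrow> 'h" where
  "word_value H FM [] = undefined"
| "word_value H FM [l] = letter_value H FM l"
| "word_value H FM (l # w) = cmp H (letter_value H FM l) (word_value H FM w)"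

inductive_set generated ::
  "('o, 'm, 'z) category_scheme \<Rightarrow> ('p, 'h, 'x) category_scheme \<Rightarrow> ('m \<Rightarrow> 'h) \<Rightarrow> 'h set"
  for \<Lambda> H FM where
  letter: "\<alpha> \<in> Mor \<Lambda> \<Longrightarrow> letter_value H FM (\<alpha>, e) \<in> generated \<Lambda> H FM"
| step: "\<alpha> \<in> Mor \<Lambda> \<Longrightarrow> b \<in> generated \<Lambda> H FM \<Longrightarrow> src H (letter_value H FM (\<alpha>, e)) = rng H b \<Longrightarrow>
    cmp H (letter_value H FM (\<alpha>, e)) b \<in> generated \<Lambda> H FM"

lemma generated_word: "a \<in> generated \<Lambda> H FM \<Longrightarrow> \<exists>w. w \<noteq> [] \<and> a = word_value H FM w"
proof (induction rule: generated.induct)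
  case (letter \<alpha> e)
  show ?case by (rule exI[of _ "[(\<alpha>, e)]"]) simp
next
  case (step \<alpha> b e)
  then obtain w where w: "w \<noteq> []" "b = word_value H FM w" by blast
  then show ?case by (intro exI[of _ "(\<alpha>, e) # w"]) (cases w; simp)
qed

locale functor_to_groupoid = \<Lambda>: small_category \<Lambda> + H: groupoid H + cat_functor \<Lambda> H FO FM
  for \<Lambda> :: "('o, 'm, 'z) category_scheme" and H :: "('p, 'h) category"
    and FO :: "'o \<Rightarrow> 'p" and FM :: "'m \<Rightarrow> 'h"
begin

abbreviation "gen \<equiv> generated \<Lambda> H FM"
abbreviation "val \<equiv> letter_value H FM"

lemma val_True: "val (\<alpha>, True) = FM \<alpha>"
  by (simp add: letter_value_def)

lemma val_False: "\<alpha> \<in> Mor \<Lambda> \<Longrightarrow> inverse_of H (FM \<alpha>) (val (\<alpha>, False))"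
  using someI_ex[OF H.ex_inverse[OF FM_Mor]] by (simp add: letter_value_def)

lemma val_Mor: "\<alpha> \<in> Mor \<Lambda> \<Longrightarrow> val (\<alpha>, e) \<in> Mor H"
  using FM_Mor val_False by (cases e) (auto simp: val_True inverse_of_def)

lemma val_src: "\<alpha> \<in> Mor \<Lambda> \<Longrightarrow> src H (val (\<alpha>, e)) = FO (if e then src \<Lambda> \<alpha> else rng \<Lambda> \<alpha>)"
  using FM_src FM_rng val_False by (cases e) (auto simp: val_True inverse_of_def)

lemma val_rng: "\<alpha> \<in> Mor \<Lambda> \<Longrightarrow> rng H (val (\<alpha>, e)) = FO (if e then rng \<Lambda> \<alpha> else src \<Lambda> \<alpha>)"
  using FM_src FM_rng val_False by (cases e) (auto simp: val_True inverse_of_def)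

lemma val_inverse: "\<alpha> \<in> Mor \<Lambda> \<Longrightarrow> inverse_of H (val (\<alpha>, e)) (val (\<alpha>, \<not> e))"
  using val_False H.inverse_of_sym FM_Mor by (cases e) (auto simp: val_True)

lemma gen_Mor: "a \<in> gen \<Longrightarrow> a \<in> Mor H"
  by (induction rule: generated.induct) (auto simp: val_Mor H.cmp_Mor)

lemma gen_src: "a \<in> gen \<Longrightarrow> src H a \<in> FO ` Obj \<Lambda>"
proof (induction rule: generated.induct)
  case (letter \<alpha> e) then show ?case by (simp add: val_src \<Lambda>.src_Obj \<Lambda>.rng_Obj)
next
  case (step \<alpha> b e) then show ?case by (simp add: H.src_cmp gen_Mor val_Mor)
qed

lemma gen_rng: "a \<in> gen \<Longrightarrow> rng H a \<in> FO ` Obj \<Lambda>"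
proof (induction rule: generated.induct)
  case (letter \<alpha> e) then show ?case by (simp add: val_rng \<Lambda>.src_Obj \<Lambda>.rng_Obj)
next
  case (step \<alpha> b e)
  then show ?case by (simp add: H.rng_cmp gen_Mor val_Mor val_rng \<Lambda>.src_Obj \<Lambda>.rng_Obj)
qed

lemma gen_cmp: "a \<in> gen \<Longrightarrow> b \<in> gen \<Longrightarrow> src H a = rng H b \<Longrightarrow> cmp H a b \<in> gen"
proof (induction rule: generated.induct)
  case (letter \<alpha> e) then show ?case by (simp add: generated.step)
next
  case (step \<alpha> c e)
  have m: "val (\<alpha>, e) \<in> Mor H" "c \<in> Mor H" "b \<in> Mor H" using step gen_Mor val_Mor by auto
  have s: "src H c = rng H b" using step m by (simp add: H.src_cmp)
  have "cmp H (val (\<alpha>, e)) (cmp H c b) \<in> gen"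
    using step s m by (intro generated.step) (auto simp: H.rng_cmp)
  then show ?case using step s m by (simp add: H.cmp_assoc)
qed

lemma gen_inverse: "a \<in> gen \<Longrightarrow> \<exists>b\<in>gen. inverse_of H a b"
proof (induction rule: generated.induct)
  case (letter \<alpha> e)
  show ?case
    by (rule bexI[of _ "val (\<alpha>, \<not> e)"]) (rule val_inverse[OF letter] generated.letter[OF letter])+
next
  case (step \<alpha> c e)
  then obtain d where d: "d \<in> gen" "inverse_of H c d" by blast
  have "inverse_of H (cmp H (val (\<alpha>, e)) c) (cmp H d (val (\<alpha>, \<not> e)))"
    using step d by (intro H.inverse_of_cmp val_inverse) (auto simp: val_Mor gen_Mor)
  moreover have "cmp H d (val (\<alpha>, \<not> e)) \<in> gen"
  proof (rule gen_cmp)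
    show "src H d = rng H (val (\<alpha>, \<not> e))"
      using d step by (cases e) (auto simp: inverse_of_def val_rng val_src)
  qed (use d step in \<open>simp_all add: generated.letter\<close>)
  ultimately show ?case by blast
qed

lemma gen_FM: "\<alpha> \<in> Mor \<Lambda> \<Longrightarrow> FM \<alpha> \<in> gen"
  using generated.letter[of \<alpha> \<Lambda> H FM True] by (simp add: val_True)

lemma gen_idt: "x \<in> FO ` Obj \<Lambda> \<Longrightarrow> idt H x \<in> gen"
  using gen_FM[OF \<Lambda>.idt_Mor] by (auto simp: FM_idt)

definition Hgen :: "('p, 'h) category" where
  "Hgen = H\<lparr>Obj := FO ` Obj \<Lambda>, Mor := gen\<rparr>"

lemma Hgen_simps [simp]:
  "Obj Hgen = FO ` Obj \<Lambda>" "Mor Hgen = gen" "src Hgen = src H" "rng Hgen = rng H"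
  "idt Hgen = idt H" "cmp Hgen = cmp H"
  by (simp_all add: Hgen_def)

lemma groupoid_Hgen: "groupoid Hgen"
proof -
  have O: "x \<in> FO ` Obj \<Lambda> \<Longrightarrow> x \<in> Obj H" for x using FO_Obj by blast
  have "small_category Hgen"
    by unfold_locales
       (simp_all add: gen_src gen_rng gen_idt gen_cmp gen_Mor O H.src_idt H.rng_idt H.src_cmp H.rng_cmp
         H.cmp_idt_left H.cmp_idt_right H.cmp_assoc del: image_iff)
  moreover have "\<exists>b. inverse_of Hgen a b" if "a \<in> gen" for a
    using gen_inverse[OF that] by (auto simp: inverse_of_def)
  ultimately show ?thesis by (simp add: groupoid_def groupoid_axioms_def)
qed

lemma functor_Hgen: "cat_functor \<Lambda> Hgen FO FM"
  by unfold_locales (auto simp: gen_FM FM_src FM_rng FM_idt FM_cmp)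

lemma incl_Hgen: "cat_functor Hgen H (\<lambda>x. x) (\<lambda>a. a)"
  by unfold_locales (auto simp: gen_Mor FO_Obj)

lemma agree_on_gen:
  assumes K: "cat_functor Hgen X KO KM" and L: "cat_functor Hgen X LO LM" and X: "small_category X"
    and eq: "\<And>\<alpha>. \<alpha> \<in> Mor \<Lambda> \<Longrightarrow> KM (FM \<alpha>) = LM (FM \<alpha>)" and a: "a \<in> gen"
  shows "KM a = LM a"
proof -
  interpret Hg: groupoid Hgen by (rule groupoid_Hgen)
  interpret K: cat_functor Hgen X KO KM by (rule K)
  interpret L: cat_functor Hgen X LO LM by (rule L)
  interpret X: small_category X by (rule X)
  have val_eq: "KM (val (\<alpha>, e)) = LM (val (\<alpha>, e))" if \<alpha>: "\<alpha> \<in> Mor \<Lambda>" for \<alpha> e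
  proof (cases e)
    case True then show ?thesis using eq \<alpha> by (simp add: val_True)
  next
    case False
    have "inverse_of Hgen (FM \<alpha>) (val (\<alpha>, False))"
      using val_False[OF \<alpha>] generated.letter[OF \<alpha>, of H FM False] by (simp add: inverse_of_def)
    then have "inverse_of X (KM (FM \<alpha>)) (KM (val (\<alpha>, False)))"
      "inverse_of X (LM (FM \<alpha>)) (LM (val (\<alpha>, False)))"
      using cat_functor_inverse[OF K Hg.small_category_axioms]
        cat_functor_inverse[OF L Hg.small_category_axioms] gen_FM[OF \<alpha>] by simp_all
    moreover have "KM (FM \<alpha>) \<in> Mor X" using K.FM_Mor[of "FM \<alpha>"] gen_FM[OF \<alpha>] by simp
    ultimately have "KM (val (\<alpha>, False)) = LM (val (\<alpha>, False))"
      unfolding eq[OF \<alpha>] by (rule X.inverse_of_unique)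
    then show ?thesis using False by simp
  qed
  show ?thesis using a
  proof (induction rule: generated.induct)
    case (letter \<alpha> e) then show ?case by (rule val_eq)
  next
    case (step \<alpha> b e)
    then show ?case
      using K.FM_cmp[of "val (\<alpha>, e)" b] L.FM_cmp[of "val (\<alpha>, e)" b] val_eq
      by (simp add: generated.letter)
  qed
qed

end


section \<open>Transport of groupoids along injections\<close>

definition transport ::
  "('p \<Rightarrow> 'q) \<Rightarrow> ('h \<Rightarrow> 'k) \<Rightarrow> ('p, 'h) category \<Rightarrow> ('q, 'k) category" where
  "transport eO eM H =
     \<lparr>Obj = eO ` Obj H, Mor = eM ` Mor H,
      src = (\<lambda>a. eO (src H (inv_into (Mor H) eM a))),
      rng = (\<lambda>a. eO (rng H (inv_into (Mor H) eM a))),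
      idt = (\<lambda>x. eM (idt H (inv_into (Obj H) eO x))),
      cmp = (\<lambda>a b. eM (cmp H (inv_into (Mor H) eM a) (inv_into (Mor H) eM b)))\<rparr>"

lemma transport_groupoid:
  assumes H: "groupoid H" and O: "inj_on eO (Obj H)" and M: "inj_on eM (Mor H)"
  shows "groupoid (transport eO eM H)"
    and "cat_functor H (transport eO eM H) eO eM"
    and "cat_functor (transport eO eM H) H (inv_into (Obj H) eO) (inv_into (Mor H) eM)"
proof -
  interpret H: groupoid H by (rule H)
  note iM = inv_into_f_f[OF M] and iO = inv_into_f_f[OF O]
  note s = transport_def iM iO H.src_Obj H.rng_Obj H.idt_Mor H.src_idt H.rng_idt H.cmp_Mor H.src_cmp
    H.rng_cmp H.cmp_idt_left H.cmp_idt_right inj_on_eq_iff[OF O] inj_on_eq_iff[OF M]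
  have sc: "small_category (transport eO eM H)"
    by unfold_locales (auto simp: s H.cmp_assoc)
  have "\<exists>b. inverse_of (transport eO eM H) a b" if a: "a \<in> Mor (transport eO eM H)" for a
  proof -
    obtain c where c: "c \<in> Mor H" "a = eM c" using a by (auto simp: transport_def)
    obtain d where "inverse_of H c d" using H.ex_inverse c by blast
    then have "inverse_of (transport eO eM H) a (eM d)"
      using c by (auto simp: inverse_of_def s)
    then show ?thesis by blast
  qed
  with sc show "groupoid (transport eO eM H)" by (simp add: groupoid_def groupoid_axioms_def)
  show "cat_functor H (transport eO eM H) eO eM"
    by unfold_locales (auto simp: s)
  show "cat_functor (transport eO eM H) H (inv_into (Obj H) eO) (inv_into (Mor H) eM)"
    by unfold_locales (auto simp: s)
qed

context functor_to_groupoid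
begin

definition code :: "'h \<Rightarrow> ('m \<times> bool) list" where
  "code a = (SOME w. word_value H FM w = a)"

lemma word_value_code: "a \<in> gen \<Longrightarrow> word_value H FM (code a) = a"
  unfolding code_def by (rule someI_ex) (use generated_word in force)

lemma inj_code: "inj_on code gen"
  by (rule inj_onI) (metis word_value_code)

definition Hcode :: "('o, ('m \<times> bool) list) category" where
  "Hcode = transport (inv_into (Obj \<Lambda>) FO) code Hgen"

lemma inj_objcode: "inj_on (inv_into (Obj \<Lambda>) FO) (FO ` Obj \<Lambda>)"
  by (simp add: inj_on_inv_into)

lemma Hcode_groupoid: "groupoid Hcode"
  unfolding Hcode_def
  using transport_groupoid(1)[OF groupoid_Hgen] inj_objcode inj_code by simp

lemma Hcode_enc: "cat_functor Hgen Hcode (inv_into (Obj \<Lambda>) FO) code"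
  unfolding Hcode_def
  using transport_groupoid(2)[OF groupoid_Hgen] inj_objcode inj_code by simp

lemma Hcode_functor: "cat_functor \<Lambda> Hcode (\<lambda>x. inv_into (Obj \<Lambda>) FO (FO x)) (\<lambda>\<alpha>. code (FM \<alpha>))"
  using cat_functor_comp[OF functor_Hgen Hcode_enc] .

lemma Hcode_decode:
  "\<exists>JO JM. cat_functor Hcode H JO JM \<and> (\<forall>x\<in>Obj \<Lambda>. JO (inv_into (Obj \<Lambda>) FO (FO x)) = FO x) \<and>
     (\<forall>\<alpha>\<in>Mor \<Lambda>. JM (code (FM \<alpha>)) = FM \<alpha>)"
proof -
  have "cat_functor Hcode Hgen (inv_into (Obj Hgen) (inv_into (Obj \<Lambda>) FO)) (inv_into (Mor Hgen) code)"
    unfolding Hcode_def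
    using transport_groupoid(3)[OF groupoid_Hgen, of "inv_into (Obj \<Lambda>) FO" code] inj_objcode inj_code
    by simp
  from cat_functor_comp[OF this incl_Hgen] show ?thesis
    by (intro exI conjI ballI, assumption)
       (auto simp: inv_into_f_f[OF inj_objcode] inv_into_f_f[OF inj_code] gen_FM)
qed

lemma Hcode_agree:
  assumes K: "cat_functor Hcode X KO KM" and L: "cat_functor Hcode X LO LM" and X: "small_category X"
    and eq: "\<And>\<alpha>. \<alpha> \<in> Mor \<Lambda> \<Longrightarrow> KM (code (FM \<alpha>)) = LM (code (FM \<alpha>))" and a: "a \<in> Mor Hcode"
  shows "KM a = LM a"
proof -
  obtain b where b: "b \<in> gen" "a = code b" using a by (auto simp: Hcode_def transport_def)
  have "KM (code b) = LM (code b)"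
    by (rule agree_on_gen[OF cat_functor_comp[OF Hcode_enc K] cat_functor_comp[OF Hcode_enc L] X eq b(1)])
  then show ?thesis using b by simp
qed

end


section \<open>The universal property for groupoids of arbitrary type\<close>

lemma fundamental_groupoidD:
  assumes "fundamental_groupoid \<Lambda> G i"
  shows "groupoid G" "Obj G = Obj \<Lambda>" "cat_functor \<Lambda> G (\<lambda>x. x) i"
  using assms by (simp_all add: fundamental_groupoid_def)

lemma factors_uniquelyE:
  assumes "factors_uniquely \<Lambda> G i H FO FM"
  obtains KO KM where "cat_functor G H KO KM" "\<And>x. x \<in> Obj \<Lambda> \<Longrightarrow> KO x = FO x"
    "\<And>\<alpha>. \<alpha> \<in> Mor \<Lambda> \<Longrightarrow> KM (i \<alpha>) = FM \<alpha>"
proof -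
  have "\<exists>KO KM. cat_functor G H KO KM \<and> (\<forall>x\<in>Obj \<Lambda>. KO x = FO x) \<and> (\<forall>\<alpha>\<in>Mor \<Lambda>. KM (i \<alpha>) = FM \<alpha>)"
    using assms[unfolded factors_uniquely_def Let_def] by (rule conjunct1)
  then show thesis using that by blast
qed

lemma factors_uniquely_agree:
  assumes "factors_uniquely \<Lambda> G i H FO FM"
    and "cat_functor G H KO KM" "\<And>x. x \<in> Obj \<Lambda> \<Longrightarrow> KO x = FO x" "\<And>\<alpha>. \<alpha> \<in> Mor \<Lambda> \<Longrightarrow> KM (i \<alpha>) = FM \<alpha>"
    and "cat_functor G H LO LM" "\<And>x. x \<in> Obj \<Lambda> \<Longrightarrow> LO x = FO x" "\<And>\<alpha>. \<alpha> \<in> Mor \<Lambda> \<Longrightarrow> LM (i \<alpha>) = FM \<alpha>"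
    and "g \<in> Mor G"
  shows "KM g = LM g"
  using assms(1)[unfolded factors_uniquely_def Let_def, THEN conjunct2, rule_format,
      of KO KM LO LM, THEN conjunct2, rule_format, OF _ assms(8)] assms(2-7)
  by simp

theorem fundamental_groupoid_generated:
  fixes \<Lambda> :: "('o, 'm, 'z) category_scheme" and G :: "('o, 'g) category"
  assumes \<Lambda>: "small_category \<Lambda>" and G: "fundamental_groupoid \<Lambda> G i"
  shows "generated \<Lambda> G i = Mor G"
proof -
  note GD = fundamental_groupoidD[OF G]
  interpret \<Lambda>: small_category \<Lambda> by (rule \<Lambda>)
  interpret G: groupoid G by (rule GD)
  interpret F: functor_to_groupoid \<Lambda> G "\<lambda>x. x" i
    by (simp add: functor_to_groupoid_def \<Lambda> GD)
  let ?e = "Inr :: 'g \<Rightarrow> ('m \<times> bool) list + 'g"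
  define D where "D = transport (\<lambda>x. x) ?e F.Hgen"
  define E where "E = transport (\<lambda>x. x) ?e G"
  have inj: "inj_on ?e A" for A by (simp add: inj_on_def)
  have injO: "inj_on (\<lambda>x::'o. x) A" for A by (simp add: inj_on_def)
  note tD = transport_groupoid[OF F.groupoid_Hgen injO inj, folded D_def]
  note tE = transport_groupoid[OF GD(1) injO inj, folded E_def]
  have up: "factors_uniquely \<Lambda> G i H FO FM" if "groupoid H" "cat_functor \<Lambda> H FO FM"
    for H :: "('o, ('m \<times> bool) list + 'g) category" and FO FM
    using G that unfolding fundamental_groupoid_def by blast
  have "factors_uniquely \<Lambda> G i D (\<lambda>x. x) (\<lambda>\<alpha>. Inr (i \<alpha>))"
    by (rule up[OF tD(1) cat_functor_comp[OF F.functor_Hgen tD(2)]])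
  then obtain KO KM where K: "cat_functor G D KO KM" "\<And>x. x \<in> Obj \<Lambda> \<Longrightarrow> KO x = x"
    "\<And>\<alpha>. \<alpha> \<in> Mor \<Lambda> \<Longrightarrow> KM (i \<alpha>) = Inr (i \<alpha>)"
    unfolding factors_uniquely_def Let_def by blast
  let ?dO = "inv_into (Obj F.Hgen) (\<lambda>x::'o. x)" and ?dM = "inv_into (Mor F.Hgen) ?e"
  have J1: "cat_functor G F.Hgen (\<lambda>x. ?dO (KO x)) (\<lambda>g. ?dM (KM g))"
    by (rule cat_functor_comp[OF K(1) tD(3)])
  have J: "cat_functor G E (\<lambda>x. ?dO (KO x)) (\<lambda>g. Inr (?dM (KM g)))"
    by (rule cat_functor_comp[OF cat_functor_comp[OF J1 F.incl_Hgen] tE(2)])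
  have dO: "?dO x = x" if "x \<in> Obj \<Lambda>" for x
    using inv_into_f_f[OF injO[of "Obj F.Hgen"], of x] that by simp
  have dM: "?dM (Inr (i \<alpha>)) = i \<alpha>" if "\<alpha> \<in> Mor \<Lambda>" for \<alpha>
    using inv_into_f_f[OF inj[of "Mor F.Hgen"], of "i \<alpha>"] F.gen_FM[OF that] by simp
  have u: "factors_uniquely \<Lambda> G i E (\<lambda>x. x) (\<lambda>\<alpha>. Inr (i \<alpha>))"
    by (rule up[OF tE(1) cat_functor_comp[OF GD(3) tE(2)]])
  have "g \<in> F.gen" if g: "g \<in> Mor G" for g
  proof -
    have "?e (?dM (KM g)) = ?e g"
      by (rule factors_uniquely_agree[OF u J _ _ tE(2) _ _ g]) (simp_all add: K dO[simplified] dM[simplified])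
    then show ?thesis using cat_functor.FM_Mor[OF J1 g] by simp
  qed
  then show ?thesis using F.gen_Mor by blast
qed

theorem fundamental_groupoid_universal:
  fixes \<Lambda> :: "('o, 'm, 'z) category_scheme" and G :: "('o, 'g) category"
    and H :: "('p, 'h) category"
  assumes \<Lambda>: "small_category \<Lambda>" and G: "fundamental_groupoid \<Lambda> G i"
    and H: "groupoid H" and F: "cat_functor \<Lambda> H FO FM"
  shows "factors_uniquely \<Lambda> G i H FO FM"
proof -
  note GD = fundamental_groupoidD[OF G]
  interpret G: functor_to_groupoid \<Lambda> G "\<lambda>x. x" i by (simp add: functor_to_groupoid_def \<Lambda> GD)
  interpret F: functor_to_groupoid \<Lambda> H FO FM by (simp add: functor_to_groupoid_def \<Lambda> H F)
  let ?e = "Inl :: ('m \<times> bool) list \<Rightarrow> ('m \<times> bool) list + 'g"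
  have inj: "inj_on ?e A" for A by (simp add: inj_on_def)
  have injO: "inj_on (\<lambda>x::'o. x) A" for A by (simp add: inj_on_def)
  define D where "D = transport (\<lambda>x. x) ?e F.Hcode"
  note tD = transport_groupoid[OF F.Hcode_groupoid injO inj, folded D_def]
  have "factors_uniquely \<Lambda> G i D (\<lambda>x. inv_into (Obj \<Lambda>) FO (FO x)) (\<lambda>\<alpha>. Inl (F.code (FM \<alpha>)))"
    using G tD(1) cat_functor_comp[OF F.Hcode_functor tD(2)]
    unfolding fundamental_groupoid_def by blast
  then obtain KO KM where K: "cat_functor G D KO KM"
    "\<And>x. x \<in> Obj \<Lambda> \<Longrightarrow> KO x = inv_into (Obj \<Lambda>) FO (FO x)"
    "\<And>\<alpha>. \<alpha> \<in> Mor \<Lambda> \<Longrightarrow> KM (i \<alpha>) = Inl (F.code (FM \<alpha>))"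
    unfolding factors_uniquely_def Let_def by blast
  obtain JO JM where J: "cat_functor F.Hcode H JO JM"
    "\<And>x. x \<in> Obj \<Lambda> \<Longrightarrow> JO (inv_into (Obj \<Lambda>) FO (FO x)) = FO x"
    "\<And>\<alpha>. \<alpha> \<in> Mor \<Lambda> \<Longrightarrow> JM (F.code (FM \<alpha>)) = FM \<alpha>"
    using F.Hcode_decode by blast
  let ?dO = "inv_into (Obj F.Hcode) (\<lambda>x::'o. x)" and ?dM = "inv_into (Mor F.Hcode) ?e"
  have L: "cat_functor G H (\<lambda>x. JO (?dO (KO x))) (\<lambda>g. JM (?dM (KM g)))"
    by (rule cat_functor_comp[OF cat_functor_comp[OF K(1) tD(3)] J(1)])
  have LO: "JO (?dO (KO x)) = FO x" if "x \<in> Obj \<Lambda>" for x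
    using inv_into_f_f[OF injO[of "Obj F.Hcode"]] K(2) J(2) that
      cat_functor.FO_Obj[OF F.Hcode_functor that] by simp
  have LM: "JM (?dM (KM (i \<alpha>))) = FM \<alpha>" if "\<alpha> \<in> Mor \<Lambda>" for \<alpha>
    using inv_into_f_f[OF inj[of "Mor F.Hcode"]] K(3) J(3) that
      cat_functor.FM_Mor[OF F.Hcode_functor that] by simp
  have gen: "G.gen = Mor G" by (rule fundamental_groupoid_generated[OF \<Lambda> G])
  have "G.Hgen = G" using gen GD(2) by (simp add: G.Hgen_def)
  then have "KM g = KM' g" if "cat_functor G H KO KM" "cat_functor G H KO' KM'"
    "\<And>\<alpha>. \<alpha> \<in> Mor \<Lambda> \<Longrightarrow> KM (i \<alpha>) = KM' (i \<alpha>)" "g \<in> Mor G" for KO KM KO' KM' g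
    using G.agree_on_gen[of H KO KM KO' KM' g] that gen groupoid.axioms(1)[OF H] by simp
  then show ?thesis
    unfolding factors_uniquely_def Let_def using L LO LM GD(2)
    by (intro conjI exI[of _ "\<lambda>x. JO (?dO (KO x))"] exI[of _ "\<lambda>g. JM (?dM (KM g))"]) auto
qed


section \<open>Existence of the fundamental groupoid\<close>

text \<open>
  The fundamental groupoid is generated by the image of \<open>\<Lambda>\<close> in the product, over a fixed
  object set, of all groupoids with a fixed carrier type that receive a functor from \<open>\<Lambda>\<close>.
\<close>

type_synonym ('o, 'm) target =
  "('o, ('m \<times> bool) list) category \<times> ('o \<Rightarrow> 'o) \<times> ('m \<Rightarrow> ('m \<times> bool) list)"

definition targets :: "('o, 'm, 'z) category_scheme \<Rightarrow> ('o, 'm) target set" where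
  "targets \<Lambda> = {(H, FO, FM). groupoid H \<and> cat_functor \<Lambda> H FO FM}"

definition groupoid_product ::
  "'o set \<Rightarrow> 'j set \<Rightarrow> ('j \<Rightarrow> ('p, 'h) category) \<Rightarrow> ('j \<Rightarrow> 'o \<Rightarrow> 'p) \<Rightarrow>
   ('o, 'o \<times> ('j \<Rightarrow> 'h) \<times> 'o) category" where
  "groupoid_product V I X f =
     \<lparr>Obj = V,
      Mor = {(u, \<phi>, v). u \<in> V \<and> v \<in> V \<and>
        (\<forall>j\<in>I. \<phi> j \<in> Mor (X j) \<and> src (X j) (\<phi> j) = f j v \<and> rng (X j) (\<phi> j) = f j u) \<and>
        (\<forall>j. j \<notin> I \<longrightarrow> \<phi> j = undefined)},
      src = (\<lambda>a. snd (snd a)), rng = fst,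
      idt = (\<lambda>x. (x, \<lambda>j. if j \<in> I then idt (X j) (f j x) else undefined, x)),
      cmp = (\<lambda>a b. (fst a, \<lambda>j. if j \<in> I then cmp (X j) (fst (snd a) j) (fst (snd b) j) else undefined,
        snd (snd b)))\<rparr>"

lemma groupoid_product_groupoid:
  assumes X: "\<And>j. j \<in> I \<Longrightarrow> groupoid (X j)" and f: "\<And>j x. j \<in> I \<Longrightarrow> x \<in> V \<Longrightarrow> f j x \<in> Obj (X j)"
  shows "groupoid (groupoid_product V I X f)"
proof -
  note sc = groupoid.axioms(1)[OF X]
  have idl: "cmp (X j) (idt (X j) x) a = a" if "j \<in> I" "a \<in> Mor (X j)" "rng (X j) a = x" for j x a
    using small_category.cmp_idt_left[OF sc] that by blast
  have idr: "cmp (X j) a (idt (X j) x) = a" if "j \<in> I" "a \<in> Mor (X j)" "src (X j) a = x" for j x a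
    using small_category.cmp_idt_right[OF sc] that by blast
  have "small_category (groupoid_product V I X f)"
    by unfold_locales
      (auto simp: groupoid_product_def fun_eq_iff f idl idr
        small_category.idt_Mor[OF sc] small_category.src_idt[OF sc] small_category.rng_idt[OF sc]
        small_category.cmp_Mor[OF sc] small_category.src_cmp[OF sc] small_category.rng_cmp[OF sc]
        small_category.cmp_assoc[OF sc])
  moreover have "\<exists>b. inverse_of (groupoid_product V I X f) a b"
    if a: "a \<in> Mor (groupoid_product V I X f)" for a
  proof -
    obtain u \<phi> v where uv: "a = (u, \<phi>, v)" by (cases a)
    have \<phi>: "\<phi> j \<in> Mor (X j)" "src (X j) (\<phi> j) = f j v" "rng (X j) (\<phi> j) = f j u"
      if "j \<in> I" for j
      using a that by (simp_all add: uv groupoid_product_def)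
    have "\<forall>j. \<exists>b. j \<in> I \<longrightarrow> inverse_of (X j) (\<phi> j) b"
      using groupoid.ex_inverse[OF X] \<phi> by blast
    then obtain \<psi> where \<psi>: "\<And>j. j \<in> I \<Longrightarrow> inverse_of (X j) (\<phi> j) (\<psi> j)" by metis
    have "inverse_of (groupoid_product V I X f) a (v, \<lambda>j. if j \<in> I then \<psi> j else undefined, u)"
      using a \<phi> \<psi> by (auto simp: uv groupoid_product_def inverse_of_def fun_eq_iff)
    then show ?thesis by blast
  qed
  ultimately show ?thesis by (simp add: groupoid_def groupoid_axioms_def)
qed

lemma groupoid_product_functor:
  assumes "small_category \<Lambda>" and F: "\<And>j. j \<in> I \<Longrightarrow> cat_functor \<Lambda> (X j) (f j) (F j)"
  shows "cat_functor \<Lambda> (groupoid_product (Obj \<Lambda>) I X f) (\<lambda>x. x)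
    (\<lambda>\<alpha>. (rng \<Lambda> \<alpha>, \<lambda>j. if j \<in> I then F j \<alpha> else undefined, src \<Lambda> \<alpha>))"
proof -
  interpret small_category \<Lambda> by fact
  show ?thesis
    by unfold_locales
      (auto simp: groupoid_product_def fun_eq_iff src_Obj rng_Obj src_idt rng_idt src_cmp
        rng_cmp cat_functor.FM_Mor[OF F] cat_functor.FM_src[OF F] cat_functor.FM_rng[OF F]
        cat_functor.FM_idt[OF F] cat_functor.FM_cmp[OF F])
qed

lemma groupoid_product_projection:
  assumes "j \<in> I" and "\<And>x. x \<in> V \<Longrightarrow> f j x \<in> Obj (X j)"
  shows "cat_functor (groupoid_product V I X f) (X j) (f j) (\<lambda>a. fst (snd a) j)"
  by unfold_locales (auto simp: groupoid_product_def assms)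

theorem fundamental_groupoid_exists:
  fixes \<Lambda> :: "('o, 'm, 'z) category_scheme"
  assumes \<Lambda>: "small_category \<Lambda>"
  shows "\<exists>(G :: ('o, ('m \<times> bool) list) category) i. fundamental_groupoid \<Lambda> G i"
proof -
  let ?I = "targets \<Lambda>" and ?f = "\<lambda>j :: ('o, 'm) target. fst (snd j)"
  have T: "groupoid (fst j)" "cat_functor \<Lambda> (fst j) (?f j) (snd (snd j))" if "j \<in> ?I" for j
    using that by (auto simp: targets_def)
  have f: "?f j x \<in> Obj (fst j)" if "j \<in> ?I" "x \<in> Obj \<Lambda>" for j x
    using cat_functor.FO_Obj[OF T(2)] that by blast
  define P where "P = groupoid_product (Obj \<Lambda>) ?I fst ?f"
  define \<tau> where "\<tau> = (\<lambda>\<alpha>. (rng \<Lambda> \<alpha>, \<lambda>j. if j \<in> ?I then snd (snd j) \<alpha> else undefined, src \<Lambda> \<alpha>))"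
  have gP: "groupoid P"
    unfolding P_def by (rule groupoid_product_groupoid[OF T(1) f])
  have \<tau>: "cat_functor \<Lambda> P (\<lambda>x. x) \<tau>"
    unfolding P_def \<tau>_def by (rule groupoid_product_functor[OF \<Lambda> T(2)])
  interpret \<Lambda>: small_category \<Lambda> by (rule \<Lambda>)
  interpret P: functor_to_groupoid \<Lambda> P "\<lambda>x. x" \<tau>
    by (simp add: functor_to_groupoid_def \<Lambda> gP \<tau>)
  define G where "G = P.Hcode"
  define i where "i = (\<lambda>\<alpha>. P.code (\<tau> \<alpha>))"
  have id: "inv_into (Obj \<Lambda>) (\<lambda>x. x) x = x" if "x \<in> Obj \<Lambda>" for x
    using inv_into_f_f[of "\<lambda>x. x" "Obj \<Lambda>" x] that by (simp add: inj_on_def)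
  have G: "groupoid G" unfolding G_def by (rule P.Hcode_groupoid)
  have OG: "Obj G = Obj \<Lambda>" by (auto simp: G_def P.Hcode_def transport_def id image_iff)
  interpret I: cat_functor \<Lambda> G "\<lambda>x. inv_into (Obj \<Lambda>) (\<lambda>x. x) x" i
    unfolding G_def i_def by (rule P.Hcode_functor)
  have iG: "cat_functor \<Lambda> G (\<lambda>x. x) i"
    by unfold_locales
      (use I.FM_idt I.FM_src I.FM_rng in \<open>simp_all add: id OG \<Lambda>.src_Obj \<Lambda>.rng_Obj I.FM_Mor I.FM_cmp\<close>)
  have "factors_uniquely \<Lambda> G i H FO FM"
    if H: "groupoid H" and F: "cat_functor \<Lambda> H FO FM"
    for H :: "('o, ('m \<times> bool) list + ('m \<times> bool) list) category" and FO FM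
  proof -
    interpret F: functor_to_groupoid \<Lambda> H FO FM by (simp add: functor_to_groupoid_def \<Lambda> H F)
    define j :: "('o, 'm) target" where
      "j = (F.Hcode, \<lambda>x. inv_into (Obj \<Lambda>) FO (FO x), \<lambda>\<alpha>. F.code (FM \<alpha>))"
    have j: "j \<in> targets \<Lambda>"
      by (simp add: targets_def j_def F.Hcode_groupoid F.Hcode_functor)
    obtain JO JM where J: "cat_functor F.Hcode H JO JM"
      "\<And>x. x \<in> Obj \<Lambda> \<Longrightarrow> JO (inv_into (Obj \<Lambda>) FO (FO x)) = FO x"
      "\<And>\<alpha>. \<alpha> \<in> Mor \<Lambda> \<Longrightarrow> JM (F.code (FM \<alpha>)) = FM \<alpha>"
      using F.Hcode_decode by blast
    obtain DO DM where D: "cat_functor G P DO DM"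
      "\<And>x. x \<in> Obj \<Lambda> \<Longrightarrow> DO x = x"
      "\<And>\<alpha>. \<alpha> \<in> Mor \<Lambda> \<Longrightarrow> DM (i \<alpha>) = \<tau> \<alpha>"
      using P.Hcode_decode id unfolding G_def i_def by auto
    have "cat_functor P F.Hcode (\<lambda>x. inv_into (Obj \<Lambda>) FO (FO x)) (\<lambda>a. fst (snd a) j)"
      using groupoid_product_projection[of j ?I "Obj \<Lambda>" ?f fst, OF j f[OF j]]
      by (simp add: P_def[symmetric]) (simp add: j_def)
    note K = cat_functor_comp[OF cat_functor_comp[OF D(1) this] J(1)]
    have KM: "JM (fst (snd (DM (i \<alpha>))) j) = FM \<alpha>" if "\<alpha> \<in> Mor \<Lambda>" for \<alpha>
      using j that by (simp add: D(3) \<tau>_def J(3)) (simp add: j_def J(3) that)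
    have agreeM: "LM g = LM' g" if "cat_functor G H LO LM" "cat_functor G H LO' LM'"
      "\<And>\<alpha>. \<alpha> \<in> Mor \<Lambda> \<Longrightarrow> LM (i \<alpha>) = LM' (i \<alpha>)" "g \<in> Mor G" for LO LM LO' LM' g
      using P.Hcode_agree[of H LO LM LO' LM' g] that groupoid.axioms(1)[OF H]
      unfolding G_def i_def by blast
    show ?thesis
      unfolding factors_uniquely_def Let_def
    proof (intro conjI allI impI ballI)
      show "\<exists>KO KM. cat_functor G H KO KM \<and> (\<forall>x\<in>Obj \<Lambda>. KO x = FO x) \<and> (\<forall>\<alpha>\<in>Mor \<Lambda>. KM (i \<alpha>) = FM \<alpha>)"
        using K KM D(2) J(2)
        by (intro exI[of _ "\<lambda>x. JO (inv_into (Obj \<Lambda>) FO (FO (DO x)))"]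
            exI[of _ "\<lambda>g. JM (fst (snd (DM g)) j)"]) simp
    next
      fix KO KM KO' KM' x
      assume "(cat_functor G H KO KM \<and> (\<forall>x\<in>Obj \<Lambda>. KO x = FO x) \<and> (\<forall>\<alpha>\<in>Mor \<Lambda>. KM (i \<alpha>) = FM \<alpha>)) \<and>
        cat_functor G H KO' KM' \<and> (\<forall>x\<in>Obj \<Lambda>. KO' x = FO x) \<and> (\<forall>\<alpha>\<in>Mor \<Lambda>. KM' (i \<alpha>) = FM \<alpha>)"
        and "x \<in> Obj G"
      then show "KO x = KO' x" by (simp add: OG)
    next
      fix KO KM KO' KM' g
      assume *: "(cat_functor G H KO KM \<and> (\<forall>x\<in>Obj \<Lambda>. KO x = FO x) \<and> (\<forall>\<alpha>\<in>Mor \<Lambda>. KM (i \<alpha>) = FM \<alpha>)) \<and>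
        cat_functor G H KO' KM' \<and> (\<forall>x\<in>Obj \<Lambda>. KO' x = FO x) \<and> (\<forall>\<alpha>\<in>Mor \<Lambda>. KM' (i \<alpha>) = FM \<alpha>)"
        and g: "g \<in> Mor G"
      show "KM g = KM' g"
        by (rule agreeM[of KO KM KO' KM' g]) (use * g in simp_all)
    qed
  qed
  then have "fundamental_groupoid \<Lambda> G i"
    unfolding fundamental_groupoid_def using G OG iG by blast
  then show ?thesis by blast
qed


section \<open>Existence and uniqueness of the action corresponding to a covering\<close>

context kgraph_covering
begin

definition lift :: "'m \<Rightarrow> 'a \<Rightarrow> 'b" where
  "lift \<alpha> v = (THE \<mu>. \<mu> \<in> Mor \<Omega> \<and> src \<Omega> \<mu> = v \<and> pM \<mu> = \<alpha>)"

lemma lift_ex1: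
  assumes "\<alpha> \<in> Mor \<Lambda>" "v \<in> Obj \<Omega>" "pO v = src \<Lambda> \<alpha>"
  shows "\<exists>!\<mu>. \<mu> \<in> Mor \<Omega> \<and> src \<Omega> \<mu> = v \<and> pM \<mu> = \<alpha>"
proof -
  have "\<alpha> \<in> pM ` {\<mu> \<in> Mor \<Omega>. src \<Omega> \<mu> = v}" and "inj_on pM {\<mu> \<in> Mor \<Omega>. src \<Omega> \<mu> = v}"
    using bij_src[OF assms(2)] assms by (auto simp: bij_betw_def)
  then show ?thesis by (auto simp: inj_on_def)
qed

lemma lift:
  assumes "\<alpha> \<in> Mor \<Lambda>" "v \<in> Obj \<Omega>" "pO v = src \<Lambda> \<alpha>"
  shows "lift \<alpha> v \<in> Mor \<Omega>" "src \<Omega> (lift \<alpha> v) = v" "pM (lift \<alpha> v) = \<alpha>"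
  using theI'[OF lift_ex1[OF assms]] by (simp_all add: lift_def)

lemma lift_eqI: "\<mu> \<in> Mor \<Omega> \<Longrightarrow> lift (pM \<mu>) (src \<Omega> \<mu>) = \<mu>"
  unfolding lift_def
  by (rule the1_equality[OF lift_ex1]) (simp_all add: FM_Mor FM_src \<Omega>.src_Obj)

lemma lift_ex1_rng:
  assumes "\<alpha> \<in> Mor \<Lambda>" "v \<in> Obj \<Omega>" "pO v = rng \<Lambda> \<alpha>"
  shows "\<exists>!\<mu>. \<mu> \<in> Mor \<Omega> \<and> rng \<Omega> \<mu> = v \<and> pM \<mu> = \<alpha>"
proof -
  have "\<alpha> \<in> pM ` {\<mu> \<in> Mor \<Omega>. rng \<Omega> \<mu> = v}" and "inj_on pM {\<mu> \<in> Mor \<Omega>. rng \<Omega> \<mu> = v}"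
    using bij_rng[OF assms(2)] assms by (auto simp: bij_betw_def)
  then show ?thesis by (auto simp: inj_on_def)
qed

lemma unique_rng:
  assumes "\<mu> \<in> Mor \<Omega>" "\<nu> \<in> Mor \<Omega>" "rng \<Omega> \<mu> = rng \<Omega> \<nu>" "pM \<mu> = pM \<nu>"
  shows "\<mu> = \<nu>"
  using bij_rng[OF \<Omega>.rng_Obj[OF assms(2)]] assms by (simp add: bij_betw_def inj_on_def)

definition fibre :: "'o \<Rightarrow> 'a set" where
  "fibre x = {v \<in> Obj \<Omega>. pO v = x}"

definition fibre_map :: "'m \<Rightarrow> 'a \<Rightarrow> 'a" where
  "fibre_map \<alpha> = (\<lambda>v\<in>fibre (src \<Lambda> \<alpha>). rng \<Omega> (lift \<alpha> v))"

lemma fibre_map_bij: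
  assumes \<alpha>: "\<alpha> \<in> Mor \<Lambda>"
  shows "bij_betw (fibre_map \<alpha>) (fibre (src \<Lambda> \<alpha>)) (fibre (rng \<Lambda> \<alpha>))"
  unfolding bij_betw_def
proof
  have l: "lift \<alpha> v \<in> Mor \<Omega>" "src \<Omega> (lift \<alpha> v) = v" "pM (lift \<alpha> v) = \<alpha>"
    "rng \<Omega> (lift \<alpha> v) \<in> fibre (rng \<Lambda> \<alpha>)" if "v \<in> fibre (src \<Lambda> \<alpha>)" for v
  proof -
    show *: "lift \<alpha> v \<in> Mor \<Omega>" "src \<Omega> (lift \<alpha> v) = v" "pM (lift \<alpha> v) = \<alpha>"
      using lift[OF \<alpha>] that by (simp_all add: fibre_def)
    show "rng \<Omega> (lift \<alpha> v) \<in> fibre (rng \<Lambda> \<alpha>)"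
      using FM_rng[OF *(1)] * by (simp add: fibre_def \<Omega>.rng_Obj)
  qed
  show "inj_on (fibre_map \<alpha>) (fibre (src \<Lambda> \<alpha>))"
  proof (rule inj_onI)
    fix v w assume v: "v \<in> fibre (src \<Lambda> \<alpha>)" and w: "w \<in> fibre (src \<Lambda> \<alpha>)"
      and "fibre_map \<alpha> v = fibre_map \<alpha> w"
    then have eq: "rng \<Omega> (lift \<alpha> v) = rng \<Omega> (lift \<alpha> w)" by (simp add: fibre_map_def)
    have "lift \<alpha> v = lift \<alpha> w"
      by (rule unique_rng[OF l(1)[OF v] l(1)[OF w] eq]) (simp add: l(3)[OF v] l(3)[OF w])
    then show "v = w" using l(2)[OF v] l(2)[OF w] by metis
  qed
  show "fibre_map \<alpha> ` fibre (src \<Lambda> \<alpha>) = fibre (rng \<Lambda> \<alpha>)"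
  proof
    show "fibre_map \<alpha> ` fibre (src \<Lambda> \<alpha>) \<subseteq> fibre (rng \<Lambda> \<alpha>)"
    proof
      fix w assume "w \<in> fibre_map \<alpha> ` fibre (src \<Lambda> \<alpha>)"
      then obtain v where v: "v \<in> fibre (src \<Lambda> \<alpha>)" and w: "w = fibre_map \<alpha> v" by (rule imageE)
      show "w \<in> fibre (rng \<Lambda> \<alpha>)" using l(4)[OF v] v unfolding w fibre_map_def by simp
    qed
    show "fibre (rng \<Lambda> \<alpha>) \<subseteq> fibre_map \<alpha> ` fibre (src \<Lambda> \<alpha>)"
    proof
      fix w assume "w \<in> fibre (rng \<Lambda> \<alpha>)"
      then have "w \<in> Obj \<Omega>" "pO w = rng \<Lambda> \<alpha>" by (simp_all add: fibre_def)
      from ex1_implies_ex[OF lift_ex1_rng[OF \<alpha> this]]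
      obtain \<mu> where \<mu>: "\<mu> \<in> Mor \<Omega>" "rng \<Omega> \<mu> = w" "pM \<mu> = \<alpha>" by blast
      have "src \<Omega> \<mu> \<in> fibre (src \<Lambda> \<alpha>)"
        using \<mu> FM_src[OF \<mu>(1)] by (simp add: fibre_def \<Omega>.src_Obj)
      moreover from this have "fibre_map \<alpha> (src \<Omega> \<mu>) = w"
        using lift_eqI[OF \<mu>(1)] \<mu> by (simp add: fibre_map_def)
      ultimately show "w \<in> fibre_map \<alpha> ` fibre (src \<Lambda> \<alpha>)" by blast
    qed
  qed
qed

definition fibre_groupoid :: "('o, 'o \<times> ('a \<Rightarrow> 'a) \<times> 'o) category" where
  "fibre_groupoid =
     \<lparr>Obj = Obj \<Lambda>,
      Mor = {(u, f, v). u \<in> Obj \<Lambda> \<and> v \<in> Obj \<Lambda> \<and> f \<in> extensional (fibre v) \<and>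
        bij_betw f (fibre v) (fibre u)},
      src = (\<lambda>a. snd (snd a)), rng = fst,
      idt = (\<lambda>x. (x, \<lambda>v\<in>fibre x. v, x)),
      cmp = (\<lambda>a b. (fst a, \<lambda>v\<in>fibre (snd (snd b)). fst (snd a) (fst (snd b) v), snd (snd b)))\<rparr>"

lemma bij_betw_compose:
  assumes "bij_betw f B C" "bij_betw g A B"
  shows "bij_betw (\<lambda>v. f (g v)) A C"
  using bij_betw_trans[OF assms(2,1)] by (simp add: comp_def)

lemma groupoid_fibre_groupoid: "groupoid fibre_groupoid"
proof -
  have id: "bij_betw (\<lambda>v. v) A A" for A :: "'a set" by (auto simp: bij_betw_def inj_on_def)
  have "small_category fibre_groupoid"
    by unfold_locales
      (auto simp: fibre_groupoid_def id bij_betw_compose fun_eq_iff extensional_def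
        dest: bij_betwE)
  moreover have "\<exists>b. inverse_of fibre_groupoid a b" if a: "a \<in> Mor fibre_groupoid" for a
  proof -
    obtain u f v where uv: "a = (u, f, v)" by (cases a)
    have f: "bij_betw f (fibre v) (fibre u)" using a by (simp add: uv fibre_groupoid_def)
    define g where "g = (\<lambda>w\<in>fibre u. inv_into (fibre v) f w)"
    have g: "bij_betw g (fibre u) (fibre v)"
      using bij_betw_inv_into[OF f] by (simp add: g_def)
    have 1: "f (g w) = w" if "w \<in> fibre u" for w
      using that bij_betw_inv_into_right[OF f] by (simp add: g_def)
    have 2: "g (f w) = w" if "w \<in> fibre v" for w
      using that bij_betw_inv_into_left[OF f] bij_betwE[OF f] by (simp add: g_def)
    have 3: "g \<in> extensional (fibre u)" by (simp add: g_def)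
    have "inverse_of fibre_groupoid a (v, g, u)"
      using a g 3 by (auto simp: uv inverse_of_def fibre_groupoid_def 1 2 intro!: restrict_ext)
    then show ?thesis by blast
  qed
  ultimately show ?thesis by (simp add: groupoid_def groupoid_axioms_def)
qed

lemma fibre_functor:
  "cat_functor \<Lambda> fibre_groupoid (\<lambda>x. x) (\<lambda>\<alpha>. (rng \<Lambda> \<alpha>, fibre_map \<alpha>, src \<Lambda> \<alpha>))"
proof
  fix x assume x: "x \<in> Obj \<Lambda>"
  have "fibre_map (idt \<Lambda> x) v = (\<lambda>v\<in>fibre x. v) v" for v
  proof (cases "v \<in> fibre x")
    case True
    then have v: "v \<in> Obj \<Omega>" "pO v = x" by (simp_all add: fibre_def)
    have "lift (idt \<Lambda> x) v = idt \<Omega> v"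
      using lift_eqI[OF \<Omega>.idt_Mor[OF v(1)]] v by (simp add: FM_idt \<Omega>.src_idt)
    then show ?thesis using True x v by (simp add: fibre_map_def \<Lambda>.src_idt \<Omega>.rng_idt)
  qed (use x in \<open>simp add: fibre_map_def \<Lambda>.src_idt\<close>)
  then show "(rng \<Lambda> (idt \<Lambda> x), fibre_map (idt \<Lambda> x), src \<Lambda> (idt \<Lambda> x)) = idt fibre_groupoid x"
    using x by (auto simp: fibre_groupoid_def \<Lambda>.rng_idt \<Lambda>.src_idt)
next
  fix a b assume ab: "a \<in> Mor \<Lambda>" "b \<in> Mor \<Lambda>" "src \<Lambda> a = rng \<Lambda> b"
  have "fibre_map (cmp \<Lambda> a b) v = (\<lambda>v\<in>fibre (src \<Lambda> b). fibre_map a (fibre_map b v)) v" for v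
  proof (cases "v \<in> fibre (src \<Lambda> b)")
    case True
    then have v: "v \<in> Obj \<Omega>" "pO v = src \<Lambda> b" by (simp_all add: fibre_def)
    note m = lift[OF ab(2) v]
    have w: "rng \<Omega> (lift b v) \<in> Obj \<Omega>" "pO (rng \<Omega> (lift b v)) = src \<Lambda> a"
      using m ab FM_rng[OF m(1)] by (simp_all add: \<Omega>.rng_Obj)
    note n = lift[OF ab(1) w]
    have "lift (cmp \<Lambda> a b) v = cmp \<Omega> (lift a (rng \<Omega> (lift b v))) (lift b v)"
      using lift_eqI[OF \<Omega>.cmp_Mor[OF n(1) m(1) n(2)]] m n by (simp add: FM_cmp \<Omega>.src_cmp)
    then show ?thesis using True ab w m n
      by (simp add: fibre_map_def \<Lambda>.src_cmp \<Omega>.rng_cmp) (simp add: fibre_def)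
  qed (use ab in \<open>simp add: fibre_map_def \<Lambda>.src_cmp\<close>)
  then show "(rng \<Lambda> (cmp \<Lambda> a b), fibre_map (cmp \<Lambda> a b), src \<Lambda> (cmp \<Lambda> a b)) =
      cmp fibre_groupoid (rng \<Lambda> a, fibre_map a, src \<Lambda> a) (rng \<Lambda> b, fibre_map b, src \<Lambda> b)"
    using ab by (auto simp: fibre_groupoid_def \<Lambda>.rng_cmp \<Lambda>.src_cmp)
qed (use fibre_map_bij in \<open>auto simp: fibre_groupoid_def \<Lambda>.src_Obj \<Lambda>.rng_Obj fibre_map_def\<close>)

theorem covering_action_exists:
  fixes G :: "('o, 'g) category"
  assumes G: "fundamental_groupoid \<Lambda> G i"
  shows "\<exists>TO TM. covering_action \<Omega> \<Lambda> pO pM G i TO TM"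
proof -
  note GD = fundamental_groupoidD[OF G]
  obtain KO KM where K: "cat_functor G fibre_groupoid KO KM" "\<And>x. x \<in> Obj \<Lambda> \<Longrightarrow> KO x = x"
    "\<And>\<alpha>. \<alpha> \<in> Mor \<Lambda> \<Longrightarrow> KM (i \<alpha>) = (rng \<Lambda> \<alpha>, fibre_map \<alpha>, src \<Lambda> \<alpha>)"
    using factors_uniquelyE[OF fundamental_groupoid_universal[OF
            \<Lambda>.small_category_axioms G groupoid_fibre_groupoid fibre_functor]] by metis
  interpret G: groupoid G by (rule GD)
  interpret K: cat_functor G fibre_groupoid KO KM by (rule K)
  let ?T = "\<lambda>g. fst (snd (KM g))"
  have s: "snd (snd (KM g)) = src G g" and r: "fst (KM g) = rng G g"
    and b: "bij_betw (?T g) (fibre (src G g)) (fibre (rng G g))" if g: "g \<in> Mor G" for g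
  proof -
    show s: "snd (snd (KM g)) = src G g"
      using K.FM_src[OF g] G.src_Obj[OF g] GD(2) K(2) by (simp add: fibre_groupoid_def)
    show r: "fst (KM g) = rng G g"
      using K.FM_rng[OF g] G.rng_Obj[OF g] GD(2) K(2) by (simp add: fibre_groupoid_def)
    show "bij_betw (?T g) (fibre (src G g)) (fibre (rng G g))"
      using K.FM_Mor[OF g] s r by (cases "KM g") (simp add: fibre_groupoid_def)
  qed
  have "groupoid_action G (Obj \<Omega>) fibre ?T"
  proof
    show "disjoint_family_on fibre (Obj G)" by (auto simp: disjoint_family_on_def fibre_def)
    show "(\<Union>x\<in>Obj G. fibre x) = Obj \<Omega>" using FO_Obj GD(2) by (auto simp: fibre_def)
    show "?T a v \<in> fibre (rng G a)" if "a \<in> Mor G" "v \<in> fibre (src G a)" for a v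
      using bij_betwE[OF b] that by blast
    show "?T (idt G x) v = v" if "x \<in> Obj G" "v \<in> fibre x" for x v
      using K.FM_idt[OF that(1)] that K(2) GD(2) by (simp add: fibre_groupoid_def)
    show "?T (cmp G a c) v = ?T a (?T c v)"
      if "a \<in> Mor G" "c \<in> Mor G" "src G a = rng G c" "v \<in> fibre (src G c)" for a c v
      using K.FM_cmp[OF that(1-3)] that s by (simp add: fibre_groupoid_def)
  qed
  moreover have "?T (i (pM \<mu>)) (src \<Omega> \<mu>) = rng \<Omega> \<mu>" if "\<mu> \<in> Mor \<Omega>" for \<mu>
    using that lift_eqI[OF that] FM_src[OF that]
    by (simp add: K(3) FM_Mor fibre_map_def) (simp add: fibre_def \<Omega>.src_Obj)
  ultimately have "covering_action \<Omega> \<Lambda> pO pM G i fibre ?T"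
    by (simp add: covering_action_def fibre_def)
  then show ?thesis by blast
qed

theorem covering_action_unique:
  fixes G :: "('o, 'g) category"
  assumes G: "fundamental_groupoid \<Lambda> G i"
    and T: "covering_action \<Omega> \<Lambda> pO pM G i TO TM"
    and T': "covering_action \<Omega> \<Lambda> pO pM G i TO' TM'"
  shows "x \<in> Obj G \<Longrightarrow> TO x = TO' x"
    and "g \<in> Mor G \<Longrightarrow> v \<in> TO (src G g) \<Longrightarrow> TM g v = TM' g v"
proof -
  note GD = fundamental_groupoidD[OF G]
  interpret G: functor_to_groupoid \<Lambda> G "\<lambda>x. x" i
    by (simp add: functor_to_groupoid_def GD \<Lambda>.small_category_axioms)
  interpret T: groupoid_action G "Obj \<Omega>" TO TM using T by (simp add: covering_action_def)
  interpret T': groupoid_action G "Obj \<Omega>" TO' TM' using T' by (simp add: covering_action_def)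
  have TO: "TO x = fibre x" "TO' x = fibre x" if "x \<in> Obj G" for x
    using T T' that GD(2) by (simp_all add: covering_action_def fibre_def)
  then show "x \<in> Obj G \<Longrightarrow> TO x = TO' x" by simp
  have letter: "TM (i \<alpha>) v = TM' (i \<alpha>) v" if "\<alpha> \<in> Mor \<Lambda>" "v \<in> fibre (src \<Lambda> \<alpha>)" for \<alpha> v
  proof -
    have v: "v \<in> Obj \<Omega>" "pO v = src \<Lambda> \<alpha>" using that by (simp_all add: fibre_def)
    note l = lift[OF that(1) v]
    have "TM (i (pM (lift \<alpha> v))) (src \<Omega> (lift \<alpha> v)) = TM' (i (pM (lift \<alpha> v))) (src \<Omega> (lift \<alpha> v))"
      using T T' l(1) by (simp add: covering_action_def)
    then show ?thesis by (simp add: l)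
  qed
  have val: "TM (G.val (\<alpha>, e)) v = TM' (G.val (\<alpha>, e)) v"
    if \<alpha>: "\<alpha> \<in> Mor \<Lambda>" and v: "v \<in> fibre (src G (G.val (\<alpha>, e)))" for \<alpha> e v
  proof (cases e)
    case True then show ?thesis using letter \<alpha> v by (simp add: G.val_True G.FM_src)
  next
    case False
    let ?a = "i \<alpha>" and ?b = "G.val (\<alpha>, False)"
    have a: "?a \<in> Mor G" by (rule G.FM_Mor[OF \<alpha>])
    have b: "?b \<in> Mor G" "src G ?b = rng G ?a" "rng G ?b = src G ?a"
      "cmp G ?a ?b = idt G (rng G ?a)" "cmp G ?b ?a = idt G (src G ?a)"
      using G.val_False[OF \<alpha>] by (simp_all add: inverse_of_def)
    have O: "src G ?a \<in> Obj G" "rng G ?a \<in> Obj G" using a G.H.src_Obj G.H.rng_Obj by auto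
    have v: "v \<in> fibre (rng G ?a)" using v False b by simp
    have w: "TM ?b v \<in> fibre (src G ?a)"
      using T.TM_maps[OF b(1)] v b O by (simp add: TO)
    have "v = TM ?a (TM ?b v)"
      using T.TM_cmp[OF a b(1) b(3)[symmetric]] T.TM_idt[OF O(2)] v b O by (simp add: TO)
    also have "\<dots> = TM' ?a (TM ?b v)"
      using letter[OF \<alpha>] w by (simp add: G.FM_src[OF \<alpha>])
    finally have "TM' ?b v = TM' ?b (TM' ?a (TM ?b v))" by simp
    also have "\<dots> = TM ?b v"
      using T'.TM_cmp[OF b(1) a b(2)] T'.TM_idt[OF O(1)] w b O by (simp add: TO)
    finally show ?thesis using False by simp
  qed
  have "\<forall>v\<in>fibre (src G g). TM g v = TM' g v" if "g \<in> G.gen" for g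
    using that
  proof (induction rule: generated.induct)
    case (letter \<alpha> e) then show ?case using val by blast
  next
    case (step \<alpha> b e)
    have m: "G.val (\<alpha>, e) \<in> Mor G" "b \<in> Mor G" using step G.val_Mor G.gen_Mor by auto
    have O: "src G b \<in> Obj G" "rng G b \<in> Obj G" using m G.H.src_Obj G.H.rng_Obj by auto
    show ?case
    proof
      fix v assume "v \<in> fibre (src G (cmp G (G.val (\<alpha>, e)) b))"
      then have v: "v \<in> fibre (src G b)" using m step by (simp add: G.H.src_cmp)
      have "TM b v \<in> fibre (rng G b)" using T.TM_maps[OF m(2)] v O by (simp add: TO)
      then have "TM (G.val (\<alpha>, e)) (TM b v) = TM' (G.val (\<alpha>, e)) (TM b v)"
        using val step by simp
      then show "TM (cmp G (G.val (\<alpha>, e)) b) v = TM' (cmp G (G.val (\<alpha>, e)) b) v"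
        using T.TM_cmp[OF m step(3)] T'.TM_cmp[OF m step(3)] v O step by (simp add: TO)
    qed
  qed
  then show "g \<in> Mor G \<Longrightarrow> v \<in> TO (src G g) \<Longrightarrow> TM g v = TM' g v"
    using fundamental_groupoid_generated[OF \<Lambda>.small_category_axioms G] G.H.src_Obj TO by simp
qed

end

end

(* The orbits of the covering action are exactly the classes of the equivalence relation on the
   vertices of \<Omega> generated by the existence of a morphism. A morphism \<mu> of \<Omega> is the action of
   i (p \<mu>) on the source of \<mu>, so the orbit relation contains the generated one. Conversely,
   every element of the fundamental groupoid is a product of elements i \<alpha> and their inverses,
   and each of these moves a vertex along a lift of \<alpha>. *)

theory Submission
  imports Defs
begin

context groupoid_action
begin

text \<open>The moved point comes first, matching the order (range, source) of the pairs in
  \<open>cat_connected\<close>.\<close>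

definition orbit_rel :: "('v \<times> 'v) set" where
  "orbit_rel = {(TM a v, v) | a v. a \<in> Mor G \<and> v \<in> TO (src G a)}"

lemma fibre_unique: "v \<in> TO x \<Longrightarrow> v \<in> TO y \<Longrightarrow> x \<in> Obj G \<Longrightarrow> y \<in> Obj G \<Longrightarrow> x = y"
  using disjoint_fibres by (auto simp: disjoint_family_on_def)

lemma TM_inverse:
  assumes "a \<in> Mor G" "inverse_of G a b" "v \<in> TO (src G a)"
  shows "TM b (TM a v) = v"
  using assms TM_cmp[of b a v] TM_idt[of "src G a" v] src_Obj[of a]
  by (auto simp: inverse_of_def)

text \<open>Identities, inverses and composites in \<open>G\<close> give reflexivity, symmetry and
  transitivity.\<close>

lemma equiv_orbit_rel: "equiv V orbit_rel"
proof (rule equivI)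
  have V: "TO x \<subseteq> V" if "x \<in> Obj G" for x
    using that union_fibres by blast
  show "orbit_rel \<subseteq> V \<times> V"
    using V[OF src_Obj] V[OF rng_Obj] TM_maps by (fastforce simp: orbit_rel_def)
  show "refl_on V orbit_rel"
  proof (rule refl_onI)
    fix v assume "v \<in> V"
    then obtain x where "x \<in> Obj G" "v \<in> TO x"
      using union_fibres by blast
    then have "TM (idt G x) v = v" "idt G x \<in> Mor G" "v \<in> TO (src G (idt G x))"
      by (simp_all add: TM_idt idt_Mor src_idt)
    then show "(v, v) \<in> orbit_rel"
      unfolding orbit_rel_def by (intro CollectI exI[of _ "idt G x"] exI[of _ v]) simp
  qed
  show "sym orbit_rel"
  proof (rule symI)
    fix u v assume "(u, v) \<in> orbit_rel"
    then obtain a where a: "a \<in> Mor G" "v \<in> TO (src G a)" "u = TM a v"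
      by (auto simp: orbit_rel_def)
    obtain b where b: "inverse_of G a b"
      using ex_inverse a by blast
    have "v = TM b u" "b \<in> Mor G" "u \<in> TO (src G b)"
      using TM_inverse[OF a(1) b a(2)] TM_maps[OF a(1,2)] a(3) b
      by (simp_all add: inverse_of_def)
    then show "(v, u) \<in> orbit_rel"
      unfolding orbit_rel_def by blast
  qed
  show "trans orbit_rel"
  proof (rule transI)
    fix u v w assume "(u, v) \<in> orbit_rel" "(v, w) \<in> orbit_rel"
    then obtain a b where a: "a \<in> Mor G" "v \<in> TO (src G a)" "u = TM a v"
      and b: "b \<in> Mor G" "w \<in> TO (src G b)" "v = TM b w"
      by (auto simp: orbit_rel_def)
    \<comment> \<open>The point \<open>v\<close> lies in the fibres over both objects; as fibres are
      disjoint, \<open>a\<close> and \<open>b\<close> are composable.\<close>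
    have "src G a = rng G b"
      using fibre_unique[OF a(2), of "rng G b"] TM_maps[OF b(1,2)] a b src_Obj rng_Obj by simp
    then have "u = TM (cmp G a b) w" "cmp G a b \<in> Mor G" "w \<in> TO (src G (cmp G a b))"
      using a b by (simp_all add: TM_cmp cmp_Mor src_cmp)
    then show "(u, w) \<in> orbit_rel"
      unfolding orbit_rel_def by blast
  qed
qed

lemma action_orbit_eq: "action_orbit G TO TM v = orbit_rel\<inverse> `` {v}"
  by (auto simp: action_orbit_def orbit_rel_def)

text \<open>If one orbit is all of \<open>V\<close>, any two points are related through its base
  point. Nonemptiness enters because transitivity asks for a base point.\<close>

lemma transitive_action_iff:
  "transitive_action G V TO TM \<longleftrightarrow> V \<noteq> {} \<and> orbit_rel = V \<times> V"
proof
  assume "transitive_action G V TO TM"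
  then obtain v where v: "v \<in> V" "\<And>u. u \<in> V \<Longrightarrow> (u, v) \<in> orbit_rel"
    unfolding transitive_action_def action_orbit_eq by blast
  have "orbit_rel \<subseteq> V \<times> V" "sym orbit_rel" "trans orbit_rel"
    using equiv_orbit_rel by (auto simp: equiv_def)
  then show "V \<noteq> {} \<and> orbit_rel = V \<times> V"
    using v by (blast dest: symD transD)
next
  assume "V \<noteq> {} \<and> orbit_rel = V \<times> V"
  then show "transitive_action G V TO TM"
    unfolding transitive_action_def action_orbit_eq by blast
qed

end

text \<open>The right-hand side is the intersection that \<open>cat_connected\<close> compares with
  the full relation, so both sides of the main equivalence become statements about
  \<open>orbit_rel\<close>.\<close>

theorem (in kgraph_covering) orbit_rel_eq_generated:
  fixes G :: "('o, 'g) category"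
  assumes G: "fundamental_groupoid \<Lambda> G i"
    and T: "covering_action \<Omega> \<Lambda> pO pM G i TO TM"
  shows "groupoid_action.orbit_rel G TO TM =
    \<Inter>{R. equiv (Obj \<Omega>) R \<and> {(u, v). \<exists>\<mu>\<in>Mor \<Omega>. rng \<Omega> \<mu> = u \<and> src \<Omega> \<mu> = v} \<subseteq> R}"
proof -
  note GD = fundamental_groupoidD[OF G]
  interpret F: functor_to_groupoid \<Lambda> G "\<lambda>x. x" i
    by (simp add: functor_to_groupoid_def GD \<Lambda>.small_category_axioms)
  interpret T: groupoid_action G "Obj \<Omega>" TO TM
    using T by (simp add: covering_action_def)
  have TO: "TO x = {v \<in> Obj \<Omega>. pO v = x}" if "x \<in> Obj \<Lambda>" for x
    using T that by (simp add: covering_action_def)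
  have edge: "TM (i (pM \<mu>)) (src \<Omega> \<mu>) = rng \<Omega> \<mu>" if "\<mu> \<in> Mor \<Omega>" for \<mu>
    using T that by (simp add: covering_action_def)
  have contains: "(rng \<Omega> \<mu>, src \<Omega> \<mu>) \<in> T.orbit_rel" if \<mu>: "\<mu> \<in> Mor \<Omega>" for \<mu>
  proof -
    have "src \<Omega> \<mu> \<in> TO (src G (i (pM \<mu>)))"
      using \<mu> by (simp add: F.FM_src FM_Mor FM_src[symmetric] TO \<Lambda>.src_Obj \<Omega>.src_Obj)
    moreover have "i (pM \<mu>) \<in> Mor G"
      by (simp add: F.FM_Mor FM_Mor \<mu>)
    ultimately show ?thesis
      using edge[OF \<mu>] unfolding T.orbit_rel_def by force
  qed
  have least: "T.orbit_rel \<subseteq> R"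
    if R: "equiv (Obj \<Omega>) R" and E: "\<And>\<mu>. \<mu> \<in> Mor \<Omega> \<Longrightarrow> (rng \<Omega> \<mu>, src \<Omega> \<mu>) \<in> R" for R
  proof -
    have sym: "sym R" and trans: "trans R"
      using R by (simp_all add: equiv_def)
    \<comment> \<open>The lift of \<open>\<alpha>\<close> starting at \<open>v\<close> is a morphism
      of \<open>\<Omega>\<close> from \<open>v\<close> to \<open>TM (i \<alpha>) v\<close>.\<close>
    have pos: "(TM (i \<alpha>) v, v) \<in> R" if \<alpha>: "\<alpha> \<in> Mor \<Lambda>" and v: "v \<in> TO (src \<Lambda> \<alpha>)" for \<alpha> v
    proof -
      have v': "v \<in> Obj \<Omega>" "pO v = src \<Lambda> \<alpha>"
        using v by (simp_all add: TO \<Lambda>.src_Obj \<alpha>)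
      note l = lift[OF \<alpha> v']
      show ?thesis
        using edge[OF l(1)] E[OF l(1)] by (simp add: l)
    qed
    have val: "(TM (F.val (\<alpha>, e)) v, v) \<in> R"
      if \<alpha>: "\<alpha> \<in> Mor \<Lambda>" and v: "v \<in> TO (src G (F.val (\<alpha>, e)))" for \<alpha> e v
    proof (cases e)
      case True
      then show ?thesis
        using pos[OF \<alpha>] v by (simp add: F.val_True F.FM_src[OF \<alpha>])
    next
      case False
      let ?b = "F.val (\<alpha>, False)"
      have v: "v \<in> TO (src G ?b)"
        using v False by simp
      have b: "?b \<in> Mor G" "inverse_of G ?b (i \<alpha>)"
        using F.val_Mor[OF \<alpha>] F.val_inverse[OF \<alpha>, of False] by (simp_all add: F.val_True)
      \<comment> \<open>An inverse letter is reduced to \<open>pos\<close> at the point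
        \<open>TM ?b v\<close>, which \<open>i \<alpha>\<close> sends back to \<open>v\<close>;
        symmetry of \<open>R\<close> then reverses the pair.\<close>
      have "TM ?b v \<in> TO (src \<Lambda> \<alpha>)"
        using T.TM_maps[OF b(1) v] by (simp add: F.val_rng[OF \<alpha>])
      from pos[OF \<alpha> this] have "(v, TM ?b v) \<in> R"
        by (simp add: T.TM_inverse[OF b v])
      then show ?thesis
        using False sym by (simp add: symD)
    qed
    \<comment> \<open>Induction on words in the letters: the new leftmost letter acts last, and
      transitivity of \<open>R\<close> through \<open>TM b v\<close> joins the two moves.\<close>
    have "\<forall>v\<in>TO (src G g). (TM g v, v) \<in> R" if "g \<in> F.gen" for g
      using that
    proof (induction rule: generated.induct)
      case (letter \<alpha> e)
      then show ?case
        using val by blast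
    next
      case (step \<alpha> b e)
      have m: "F.val (\<alpha>, e) \<in> Mor G" "b \<in> Mor G"
        using step F.val_Mor F.gen_Mor by auto
      show ?case
      proof
        fix v assume "v \<in> TO (src G (cmp G (F.val (\<alpha>, e)) b))"
        then have v: "v \<in> TO (src G b)"
          using m step by (simp add: F.H.src_cmp)
        have "(TM (F.val (\<alpha>, e)) (TM b v), TM b v) \<in> R"
          using val step T.TM_maps[OF m(2) v] by simp
        moreover have "(TM b v, v) \<in> R"
          using step v by blast
        ultimately show "(TM (cmp G (F.val (\<alpha>, e)) b) v, v) \<in> R"
          using T.TM_cmp[OF m step(3) v] trans by (auto dest: transD)
      qed
    qed
    \<comment> \<open>The image of \<open>\<Lambda>\<close> generates \<open>G\<close>, so the
      induction covers every morphism of \<open>G\<close>.\<close>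
    then show ?thesis
      using fundamental_groupoid_generated[OF \<Lambda>.small_category_axioms G]
      by (auto simp: T.orbit_rel_def)
  qed
  show ?thesis
  proof
    show "T.orbit_rel \<subseteq>
        \<Inter>{R. equiv (Obj \<Omega>) R \<and> {(u, v). \<exists>\<mu>\<in>Mor \<Omega>. rng \<Omega> \<mu> = u \<and> src \<Omega> \<mu> = v} \<subseteq> R}"
      by (rule Inter_greatest) (rule least, auto)
  \<comment> \<open>The orbit relation is itself one of the equivalence relations being
    intersected.\<close>
  qed (rule Inter_lower, use contains T.equiv_orbit_rel in auto)
qed

theorem corollary3p8:
  fixes k :: nat
    and \<Omega> :: "('a, 'b) graded_category" and \<Lambda> :: "('o, 'm) graded_category"
    and pO :: "'a \<Rightarrow> 'o" and pM :: "'b \<Rightarrow> 'm"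
    and G :: "('o, 'g) category" and i :: "'m \<Rightarrow> 'g"
    and TO :: "'o \<Rightarrow> 'a set" and TM :: "'g \<Rightarrow> 'a \<Rightarrow> 'a"
  assumes "kgraph_covering k \<Omega> \<Lambda> pO pM"
    and "fundamental_groupoid \<Lambda> G i"
    and "covering_action \<Omega> \<Lambda> pO pM G i TO TM"
  shows "cat_connected \<Omega> \<longleftrightarrow> transitive_action G (Obj \<Omega>) TO TM"
proof -
  interpret kgraph_covering k \<Omega> \<Lambda> pO pM
    by (rule assms(1))
  interpret T: groupoid_action G "Obj \<Omega>" TO TM
    using assms(3) by (simp add: covering_action_def)
  show ?thesis
    \<comment> \<open>Both sides now say that \<open>orbit_rel\<close> is the full relation; the
      remaining condition that \<open>Obj \<Omega>\<close> is nonempty holds for every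
      k-graph.\<close>
    unfolding cat_connected_def T.transitive_action_iff
      orbit_rel_eq_generated[OF assms(2,3), symmetric]
    using \<Omega>.nonempty by simp
qed

end
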